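(* Let $\beta\in(0,1]$, $f,g\in L_1(\mathbb{R}_+)$ and $h\in L_1^{0,\beta}(\mathbb{R}_+)$. Then $$\underset{F_s,F_c,K}{\ast}(f,g,h)(x)=\big[(f\underset{1}{\ast}g)\underset{2}{\ast}h\big](x)$$ (as functions in $L_1(\mathbb{R}_+)$, i.e. for almost every $x>0$), and this function belongs to $L_1(\mathbb{R}_+)$.
   Context: $\mathbb{R}_+=[0,\infty)$. The polyconvolution of $f,g,h$ is $$\underset{F_s,F_c,K}{\ast}(f,g,h)(x):=\frac{1}{2\sqrt{2\pi}}\int_{\mathbb{R}_+^3}\Phi(x,u,v,w)f(u)g(v)h(w)\,du\,dv\,dw,\quad x>0,$$ $$\Phi(x,u,v,w)=e^{-w\cosh(x-u+v)}+e^{-w\cosh(x-u-v)}-e^{-w\cosh(x+u+v)}-e^{-w\cosh(x+u-v)}.$$ Sneddon's convolution: $(f\underset{1}{\ast}g)(x)=\frac{1}{\sqrt{2\pi}}\int_0^\infty f(u)\big[g(|x-u|)-g(x+u)\big]\,du$, $x>0$. Yakubovich–Britvina's convolution: $(f\underset{2}{\ast}g)(x)=\frac12\int_{\mathbb{R}_+^2}\big[e^{-u\cosh(v-x)}-e^{-u\cosh(v+x)}\big]f(v)g(u)\,du\,dv$, $x>0$. $K_0(x)=\int_0^\infty e^{-x\cosh t}\,dt$, and $L_1^{0,\beta}(\mathbb{R}_+)$ is the space of functions $h$ on $\mathbb{R}_+$ with $\int_0^\infty|h(x)|K_0(\beta x)\,dx<\infty$. *)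

theory Defs
  imports "HOL-Analysis.Analysis"
begin

text \<open>Functions on \<open>[0, \<infinity>)\<close> are modelled by functions on the whole line whose values
  at negative arguments are never used. The value type is a complete normed field (\<open>real\<close>
  and \<open>complex\<close> are instances). All integrals are Lebesgue integrals.\<close>

definition K0 :: "real \<Rightarrow> real" where
  "K0 x = (LINT t:{0..}|lebesgue. exp (- x * cosh t))"

text \<open>The integral defining \<open>K0\<close> diverges at \<open>0\<close>, where the Bochner integral returns \<open>0\<close>;
  this affects only the null set \<open>{0}\<close> in the following definition.\<close>

definition L1_0 ::
  "real \<Rightarrow> (real \<Rightarrow> 'a::{real_normed_field, banach, second_countable_topology}) set" where
  "L1_0 \<beta> = {h. set_borel_measurable lebesgue {0..} h \<and>
                set_integrable lebesgue {0..} (\<lambda>x. norm (h x) * K0 (\<beta> * x))}"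

definition Phi :: "real \<Rightarrow> real \<Rightarrow> real \<Rightarrow> real \<Rightarrow> real" where
  "Phi x u v w = exp (- w * cosh (x - u + v)) + exp (- w * cosh (x - u - v))
               - exp (- w * cosh (x + u + v)) - exp (- w * cosh (x + u - v))"

text \<open>The integrands are named because a Bochner integral is \<open>0\<close> when its integrand is not
  integrable, so that the existence of the integrals has to be expressed separately.\<close>

definition polyconv_integrand ::
  "(real \<Rightarrow> 'a) \<Rightarrow> (real \<Rightarrow> 'a) \<Rightarrow> (real \<Rightarrow> 'a) \<Rightarrow> real \<Rightarrow> real \<times> real \<times> real
    \<Rightarrow> 'a::{real_normed_field, banach, second_countable_topology}" where
  "polyconv_integrand f g h x = (\<lambda>(u, v, w). Phi x u v w *\<^sub>R (f u * g v * h w))"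

definition polyconv ::
  "(real \<Rightarrow> 'a) \<Rightarrow> (real \<Rightarrow> 'a) \<Rightarrow> (real \<Rightarrow> 'a) \<Rightarrow> real
    \<Rightarrow> 'a::{real_normed_field, banach, second_countable_topology}" where
  "polyconv f g h x = (1 / (2 * sqrt (2 * pi))) *\<^sub>R
     (LINT p:{0..} \<times> {0..} \<times> {0..}|lebesgue. polyconv_integrand f g h x p)"

definition sneddon_integrand ::
  "(real \<Rightarrow> 'a) \<Rightarrow> (real \<Rightarrow> 'a) \<Rightarrow> real \<Rightarrow> real
    \<Rightarrow> 'a::{real_normed_field, banach, second_countable_topology}" where
  "sneddon_integrand f g x u = f u * (g \<bar>x - u\<bar> - g (x + u))"

definition sneddon_conv ::
  "(real \<Rightarrow> 'a) \<Rightarrow> (real \<Rightarrow> 'a) \<Rightarrow> real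
    \<Rightarrow> 'a::{real_normed_field, banach, second_countable_topology}" where
  "sneddon_conv f g x = (1 / sqrt (2 * pi)) *\<^sub>R
     (LINT u:{0..}|lebesgue. sneddon_integrand f g x u)"

definition yb_integrand ::
  "(real \<Rightarrow> 'a) \<Rightarrow> (real \<Rightarrow> 'a) \<Rightarrow> real \<Rightarrow> real \<times> real
    \<Rightarrow> 'a::{real_normed_field, banach, second_countable_topology}" where
  "yb_integrand f g x =
     (\<lambda>(u, v). (exp (- u * cosh (v - x)) - exp (- u * cosh (v + x))) *\<^sub>R (f v * g u))"

definition yb_conv ::
  "(real \<Rightarrow> 'a) \<Rightarrow> (real \<Rightarrow> 'a) \<Rightarrow> real
    \<Rightarrow> 'a::{real_normed_field, banach, second_countable_topology}" where
  "yb_conv f g x = (1 / 2) *\<^sub>R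
     (LINT p:{0..} \<times> {0..}|lebesgue. yb_integrand f g x p)"

end

theory Submission imports Defs begin

text \<open>Let \<open>F\<close> and \<open>H\<close> be \<open>f\<close> and \<open>h\<close> extended by \<open>0\<close> to the line, let \<open>E v = g \<bar>v\<bar>\<close> be the even
  extension of \<open>g\<close>, and let \<open>k\<close> be the kernel
  \<open>k w x y = exp (- w * cosh (y - x)) - exp (- w * cosh (y + x))\<close>, which is odd in \<open>y\<close>. Both sides of
  the identity are the same multiple of the integral of \<open>k w x (u + v) * F u * E v * H w\<close> over all
  real \<open>u\<close>, \<open>v\<close>, \<open>w\<close>.

  For the polyconvolution this holds because \<open>Phi x u v w = k w x (u + v) + k w x (u - v)\<close>: folding the
  integral over \<open>v\<close> onto the half line gives the defining integral
  (\<open>polyconv_eq_line_integral\<close>). For the iterated convolution, Sneddon's convolution is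
  up to a constant the odd part of the ordinary convolution of \<open>F\<close> and \<open>E\<close>
  (\<open>sneddon_conv_eq_line_integral\<close>). Integrating it over the half line against the odd kernel \<open>k\<close> is
  the same as integrating the whole convolution over the line, and \<open>y = u + v\<close> gives the claim
  (\<open>yb_conv_eq_line_integral\<close>).

  All interchanges of integrals rest on one estimate: the integral of \<open>exp (- w * cosh (x + a))\<close>
  over real \<open>x\<close> is at most \<open>2 K0 w\<close>, uniformly in \<open>a\<close>. Hence the common integrand is integrable
  jointly in \<open>x\<close> and \<open>(u, v, w)\<close> (\<open>integrable_line_integrand\<close>), so Fubini's theorem yields at once
  its integrability in \<open>(u, v, w)\<close> for almost every \<open>x\<close> and the integrability of the polyconvolution.
  The given functions are only Lebesgue measurable; they are replaced by Borel representatives,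
  which changes the integrands on null sets only (\<open>lebesgue_integral_borel_cong\<close>).\<close>

section \<open>Borel representatives and Lebesgue measure on products\<close>

lemma borel_measurable_fst [measurable]:
    "(fst :: 'a::topological_space \<times> 'b::topological_space \<Rightarrow> 'a) \<in> borel_measurable borel"
  and borel_measurable_snd [measurable]:
    "(snd :: 'a \<times> 'b \<Rightarrow> 'b) \<in> borel_measurable borel"
  by (auto intro!: borel_measurable_continuous_onI continuous_intros)

text \<open>Lebesgue measurable functions do not compose well with maps such as \<open>(y, u) \<mapsto> y - u\<close>, so
  every argument is carried out for Borel representatives. One exists because a measurable function
  is a pointwise limit of simple functions, each of which agrees with a Borel simple function off a
  null set; the countable union of these null sets is still null.\<close>

lemma borel_representative:
  fixes f :: "'b \<Rightarrow> 'c::{metric_space, second_countable_topology}"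
  assumes f: "f \<in> borel_measurable (completion M)"
  obtains f' where "f' \<in> borel_measurable M" "AE x in M. f x = f' x"
proof -
  fix z :: 'c
  obtain s where s: "\<And>i. simple_function (completion M) (s i)"
      and lim: "\<And>x. x \<in> space M \<Longrightarrow> (\<lambda>i. s i x) \<longlonglongrightarrow> f x"
    using borel_measurable_implies_sequence_metric[OF f, of z] by auto
  obtain s' where s': "\<And>i. simple_function M (s' i)" and ae: "\<And>i. AE x in M. s i x = s' i x"
    using completion_ex_simple_function[OF s] by metis
  have "AE x in M. \<forall>i. s i x = s' i x"
    using ae by (simp add: AE_all_countable)
  then obtain N where N: "N \<in> null_sets M" "\<And>x. x \<in> space M - N \<Longrightarrow> \<forall>i. s i x = s' i x"
    by (auto elim!: AE_E3)
  let ?t = "\<lambda>i x. if x \<in> N then z else s' i x"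
  let ?f = "\<lambda>x. if x \<in> N then z else f x"
  have [measurable]: "N \<in> sets M" using N by auto
  have [measurable]: "s' i \<in> borel_measurable M" for i
    by (rule borel_measurable_simple_function) (rule s')
  have "?f \<in> borel_measurable M"
  proof (rule borel_measurable_LIMSEQ_metric)
    show "?t i \<in> borel_measurable M" for i by measurable
    show "(\<lambda>i. ?t i x) \<longlonglongrightarrow> ?f x" if "x \<in> space M" for x
      using lim[OF that] N(2)[of x] that by (cases "x \<in> N") auto
  qed
  moreover have "AE x in M. f x = ?f x"
    using AE_not_in[OF N(1)] by eventually_elim auto
  ultimately show ?thesis by (rule that)
qed

text \<open>Completeness of the Lebesgue measure makes \<open>f\<close> measurable. Thus one almost everywhere equality
  with a Borel function transfers both existence and value of an integral back to the original
  integrands.\<close>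

lemma lebesgue_integral_borel_cong:
  fixes f g :: "'b::euclidean_space \<Rightarrow> 'c::{banach, second_countable_topology}"
  assumes g: "g \<in> borel_measurable borel" and ae: "AE x in lborel. f x = g x"
  shows "integrable lebesgue f \<longleftrightarrow> integrable lborel g"
    and "integral\<^sup>L lebesgue f = integral\<^sup>L lborel g"
proof -
  have ae': "AE x in lebesgue. f x = g x" using ae by (rule AE_completion)
  have g': "g \<in> borel_measurable lborel" using g by simp
  have gl: "g \<in> borel_measurable lebesgue" using measurable_completion[OF g'] .
  have fl: "f \<in> borel_measurable lebesgue"
  proof (rule measurableI)
    fix A :: "'c set" assume A: "A \<in> sets borel"
    show "f -` A \<inter> space lebesgue \<in> sets lebesgue"
    proof (rule completion.in_sets_AE)
      show "g -` A \<inter> space lebesgue \<in> sets lebesgue"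
        using gl A by (rule measurable_sets)
      show "AE x in lebesgue. (x \<in> g -` A \<inter> space lebesgue) = (x \<in> f -` A \<inter> space lebesgue)"
        using ae' by eventually_elim auto
    qed auto
  qed auto
  show "integrable lebesgue f \<longleftrightarrow> integrable lborel g"
    using integrable_cong_AE[OF fl gl ae'] integrable_completion[OF g'] by simp
  show "integral\<^sup>L lebesgue f = integral\<^sup>L lborel g"
    using integral_cong_AE[OF fl gl ae'] integral_completion[OF g'] by simp
qed

lemma AE_lborel_fst:
  assumes "AE x in lborel. P x"
  shows "AE z in lborel. P (fst (z :: 'a::euclidean_space \<times> 'b::euclidean_space))"
proof -
  obtain N where N: "N \<in> null_sets lborel" "\<And>x. x \<in> space lborel - N \<Longrightarrow> P x"
    using assms by (auto elim!: AE_E3)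
  have "N \<times> (UNIV :: 'b set) \<in> null_sets (lborel \<Otimes>\<^sub>M lborel)"
    using N(1) by (auto simp: null_sets_def lborel.emeasure_pair_measure_Times intro!: pair_measureI)
  then have "N \<times> (UNIV :: 'b set) \<in> null_sets lborel" by (simp add: lborel_prod)
  from AE_not_in[OF this] show ?thesis
    by eventually_elim (use N(2) in \<open>auto simp: mem_Times_iff\<close>)
qed

lemma AE_lborel_snd:
  assumes "AE x in lborel. P x"
  shows "AE z in lborel. P (snd (z :: 'a::euclidean_space \<times> 'b::euclidean_space))"
proof -
  obtain N where N: "N \<in> null_sets lborel" "\<And>x. x \<in> space lborel - N \<Longrightarrow> P x"
    using assms by (auto elim!: AE_E3)
  have "(UNIV :: 'a set) \<times> N \<in> null_sets (lborel \<Otimes>\<^sub>M lborel)"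
    using N(1) by (auto simp: null_sets_def lborel.emeasure_pair_measure_Times intro!: pair_measureI)
  then have "(UNIV :: 'a set) \<times> N \<in> null_sets lborel" by (simp add: lborel_prod)
  from AE_not_in[OF this] show ?thesis
    by eventually_elim (use N(2) in \<open>auto simp: mem_Times_iff\<close>)
qed

lemma integrable_lborel_mult_prod:
  fixes f :: "'b::euclidean_space \<Rightarrow> 'a::{real_normed_field, banach, second_countable_topology}"
    and g :: "'c::euclidean_space \<Rightarrow> 'a"
  assumes f: "integrable lborel f" and g: "integrable lborel g"
  shows "integrable lborel (\<lambda>(x, y). f x * g y)"
proof -
  have [measurable]: "f \<in> borel_measurable borel" "g \<in> borel_measurable borel"
    using f g borel_measurable_integrable by fastforce+
  have "integrable (lborel \<Otimes>\<^sub>M lborel) (\<lambda>(x, y). f x * g y)"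
  proof (rule lborel_pair.Fubini_integrable)
    show "(\<lambda>(x, y). f x * g y) \<in> borel_measurable (lborel \<Otimes>\<^sub>M lborel)" by measurable
    show "integrable lborel (\<lambda>x. LINT y|lborel. norm (case (x, y) of (x, y) \<Rightarrow> f x * g y))"
      using f by (simp add: norm_mult integrable_norm)
    show "AE x in lborel. integrable lborel (\<lambda>y. case (x, y) of (x, y) \<Rightarrow> f x * g y)"
      using g by simp
  qed
  then show ?thesis by (simp add: lborel_prod)
qed

lemma integrable_lborel_slices:
  fixes g :: "'b::euclidean_space \<Rightarrow> 'c::euclidean_space \<Rightarrow> 'd::{banach, second_countable_topology}"
  assumes "integrable lborel (\<lambda>(x, y). g x y)"
  shows "AE x in lborel. integrable lborel (g x)"
    and "integrable lborel (\<lambda>x. LINT y|lborel. g x y)"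
    and "(LINT x|lborel. LINT y|lborel. g x y) = (LINT (x, y)|lborel. g x y)"
proof -
  have *: "integrable (lborel \<Otimes>\<^sub>M lborel) (\<lambda>(x, y). g x y)"
    using assms by (simp add: lborel_prod)
  show "AE x in lborel. integrable lborel (g x)"
    using lborel_pair.AE_integrable_fst'[OF *] by simp
  show "integrable lborel (\<lambda>x. LINT y|lborel. g x y)"
    using lborel_pair.integrable_fst'[OF *] by simp
  show "(LINT x|lborel. LINT y|lborel. g x y) = (LINT (x, y)|lborel. g x y)"
    using lborel_pair.integral_fst'[OF *] by (simp add: lborel_prod)
qed

section \<open>Measure preserving shears and reflections\<close>

lemma lborel_distr_eqI:
  fixes T :: "'b::euclidean_space \<Rightarrow> 'c::euclidean_space"
  assumes T[measurable]: "T \<in> borel_measurable borel"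
    and eq: "\<And>f :: 'c \<Rightarrow> ennreal. f \<in> borel_measurable borel \<Longrightarrow>
      (\<integral>\<^sup>+p. f (T p) \<partial>lborel) = (\<integral>\<^sup>+q. f q \<partial>lborel)"
  shows "distr lborel borel T = lborel"
proof (rule measure_eqI)
  fix A assume "A \<in> sets (distr lborel borel T)"
  then have [measurable]: "A \<in> sets borel" by simp
  have "emeasure (distr lborel borel T) A = (\<integral>\<^sup>+q. indicator A q \<partial>distr lborel borel T)"
    by simp
  also have "\<dots> = (\<integral>\<^sup>+p. indicator A (T p) \<partial>lborel)"
    by (subst nn_integral_distr) auto
  also have "\<dots> = (\<integral>\<^sup>+q. indicator A q \<partial>lborel)" by (rule eq) measurable
  finally show "emeasure (distr lborel borel T) A = emeasure lborel A" by simp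
qed simp

lemma nn_integral_lborel_reflect:
  fixes f :: "real \<Rightarrow> ennreal"
  assumes "f \<in> borel_measurable borel"
  shows "(\<integral>\<^sup>+y. f (t - y) \<partial>lborel) = (\<integral>\<^sup>+y. f y \<partial>lborel)"
  using nn_integral_real_affine[OF assms, of "-1" t] by simp

lemma nn_integral_lborel_shift:
  fixes f :: "real \<Rightarrow> ennreal"
  assumes "f \<in> borel_measurable borel"
  shows "(\<integral>\<^sup>+y. f (t + y) \<partial>lborel) = (\<integral>\<^sup>+y. f y \<partial>lborel)"
  using nn_integral_real_affine[OF assms, of "1" t] by simp

lemma nn_integral_lborel_fst:
  fixes f :: "'b::euclidean_space \<times> 'c::euclidean_space \<Rightarrow> ennreal"
  assumes "f \<in> borel_measurable borel"
  shows "(\<integral>\<^sup>+p. f p \<partial>lborel) = (\<integral>\<^sup>+x. \<integral>\<^sup>+y. f (x, y) \<partial>lborel \<partial>lborel)"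
  by (subst lborel.nn_integral_fst) (use assms in \<open>simp_all add: lborel_prod\<close>)

lemma nn_integral_lborel_snd:
  fixes f :: "'b::euclidean_space \<times> 'c::euclidean_space \<Rightarrow> ennreal"
  assumes "f \<in> borel_measurable borel"
  shows "(\<integral>\<^sup>+p. f p \<partial>lborel) = (\<integral>\<^sup>+y. \<integral>\<^sup>+x. f (x, y) \<partial>lborel \<partial>lborel)"
  using assms by (subst lborel_pair.nn_integral_snd) (simp_all add: lborel_prod)

lemma lborel_distr_reflect: "distr lborel borel (\<lambda>y::real. t - y) = lborel"
  by (rule lborel_distr_eqI) (simp_all add: nn_integral_lborel_reflect)

lemma AE_lborel_reflect:
  fixes t :: real
  assumes "AE y in lborel. P y"
  shows "AE y in lborel. P (t - y)"
proof (rule AE_distrD[of "\<lambda>y. t - y" lborel borel P])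
  show "AE y in distr lborel borel (\<lambda>y. t - y). P y" using assms by (simp only: lborel_distr_reflect)
qed simp

lemma lborel_distr_reflect_snd:
  "distr lborel borel (\<lambda>p::'b::euclidean_space \<times> real. (fst p, - snd p)) = lborel"
proof (rule lborel_distr_eqI)
  fix f :: "'b \<times> real \<Rightarrow> ennreal" assume [measurable]: "f \<in> borel_measurable borel"
  show "(\<integral>\<^sup>+p. f (fst p, - snd p) \<partial>lborel) = (\<integral>\<^sup>+q. f q \<partial>lborel)"
    using nn_integral_lborel_reflect[of "\<lambda>y. f (x, y)" 0 for x]
    by (simp add: nn_integral_lborel_fst)
qed measurable

lemma lborel_distr_reflect_middle:
  "distr lborel borel (\<lambda>p::'b::euclidean_space \<times> real \<times> 'c::euclidean_space.
     (fst p, - fst (snd p), snd (snd p))) = lborel"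
proof (rule lborel_distr_eqI)
  fix f :: "'b \<times> real \<times> 'c \<Rightarrow> ennreal" assume [measurable]: "f \<in> borel_measurable borel"
  show "(\<integral>\<^sup>+p. f (fst p, - fst (snd p), snd (snd p)) \<partial>lborel) = (\<integral>\<^sup>+q. f q \<partial>lborel)"
    using nn_integral_lborel_reflect[of "\<lambda>y. \<integral>\<^sup>+z. f (x, y, z) \<partial>lborel" 0 for x]
    by (simp add: nn_integral_lborel_fst)
qed measurable

text \<open>The substitution \<open>v = y - u\<close> that turns a convolution integral into a product integral: the
  factors of the integrand become independent in the coordinates \<open>(u, v)\<close>.\<close>

lemma lborel_distr_shear:
  "distr lborel borel (\<lambda>p::real \<times> real. (snd p, fst p - snd p)) = lborel"
proof (rule lborel_distr_eqI)
  fix f :: "real \<times> real \<Rightarrow> ennreal" assume [measurable]: "f \<in> borel_measurable borel"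
  have "(\<integral>\<^sup>+p. f (snd p, fst p - snd p) \<partial>lborel) = (\<integral>\<^sup>+u. \<integral>\<^sup>+y. f (u, - u + y) \<partial>lborel \<partial>lborel)"
    by (simp add: nn_integral_lborel_snd)
  also have "\<dots> = (\<integral>\<^sup>+u. \<integral>\<^sup>+v. f (u, v) \<partial>lborel \<partial>lborel)"
    by (subst nn_integral_lborel_shift) simp_all
  finally show "(\<integral>\<^sup>+p. f (snd p, fst p - snd p) \<partial>lborel) = (\<integral>\<^sup>+q. f q \<partial>lborel)"
    by (simp add: nn_integral_lborel_fst)
qed measurable

text \<open>The same substitution with a spectator variable \<open>w\<close>. It also matches the order
  \<open>((w, y), u)\<close>, in which the double integral over \<open>(w, y)\<close> has the integral of Sneddon's
  convolution inside, with the order \<open>(u, v, w)\<close> of the polyconvolution.\<close>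

lemma lborel_distr_shear_weighted:
  "distr lborel borel (\<lambda>p::(real \<times> real) \<times> real.
     (snd p, snd (fst p) - snd p, fst (fst p))) = lborel"
proof (rule lborel_distr_eqI)
  fix f :: "real \<times> real \<times> real \<Rightarrow> ennreal" assume [measurable]: "f \<in> borel_measurable borel"
  have "(\<integral>\<^sup>+p. f (snd p, snd (fst p) - snd p, fst (fst p)) \<partial>lborel)
      = (\<integral>\<^sup>+u. \<integral>\<^sup>+y. \<integral>\<^sup>+w. f (u, - u + y, w) \<partial>lborel \<partial>lborel \<partial>lborel)"
    by (simp add: nn_integral_lborel_snd)
  also have "\<dots> = (\<integral>\<^sup>+u. \<integral>\<^sup>+v. \<integral>\<^sup>+w. f (u, v, w) \<partial>lborel \<partial>lborel \<partial>lborel)"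
    by (subst nn_integral_lborel_shift) simp_all
  finally show "(\<integral>\<^sup>+p. f (snd p, snd (fst p) - snd p, fst (fst p)) \<partial>lborel) = (\<integral>\<^sup>+q. f q \<partial>lborel)"
    by (simp add: nn_integral_lborel_fst)
qed measurable

text \<open>Folding an integral over the whole space along a reflection \<open>\<rho>\<close> that changes the sign of the
  coordinate \<open>c\<close>. The hyperplane \<open>c = 0\<close> is counted twice after folding, whence the requirement
  that it be a null set.\<close>

lemma integral_fold_reflection:
  fixes R :: "'b::euclidean_space \<Rightarrow> 'c::{banach, second_countable_topology}"
  assumes R: "integrable lborel R"
    and \<rho>: "\<rho> \<in> borel_measurable borel" "distr lborel borel \<rho> = lborel"
    and c: "c \<in> borel_measurable borel" "\<And>p. c (\<rho> p) = - c p" "AE p in lborel. c p \<noteq> (0::real)"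
  shows "integrable lborel (\<lambda>p. indicator {0..} (c p) *\<^sub>R (R p + R (\<rho> p)))"
    and "(LINT p|lborel. indicator {0..} (c p) *\<^sub>R (R p + R (\<rho> p))) = integral\<^sup>L lborel R"
proof -
  note [measurable] = \<rho>(1) c(1)
  have [measurable]: "R \<in> borel_measurable borel"
    using R borel_measurable_integrable by fastforce
  let ?i = "\<lambda>p. indicator {0..} (c p) :: real" and ?j = "\<lambda>p. indicator {..0} (c p) :: real"
  have inti: "integrable lborel (\<lambda>p. ?i p *\<^sub>R R p)" and intj: "integrable lborel (\<lambda>p. ?j p *\<^sub>R R p)"
    using R by (auto intro!: Bochner_Integration.integrable_bound[OF R] split: split_indicator)
  have eq: "(\<lambda>p. ?i p *\<^sub>R R (\<rho> p)) = (\<lambda>p. (\<lambda>p. ?j p *\<^sub>R R p) (\<rho> p))"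
    using c(2) by (auto simp: fun_eq_iff split: split_indicator)
  have intr: "integrable lborel (\<lambda>p. ?i p *\<^sub>R R (\<rho> p))"
    unfolding eq using intj by (subst integrable_distr_eq[symmetric, of _ _ borel]) (auto simp: \<rho>(2))
  have ler: "(LINT p|lborel. ?i p *\<^sub>R R (\<rho> p)) = (LINT p|lborel. ?j p *\<^sub>R R p)"
    unfolding eq by (subst integral_distr[symmetric, of _ _ borel]) (auto simp: \<rho>(2))
  show "integrable lborel (\<lambda>p. ?i p *\<^sub>R (R p + R (\<rho> p)))"
    unfolding scaleR_add_right using inti intr by (rule Bochner_Integration.integrable_add)
  have "(LINT p|lborel. ?i p *\<^sub>R (R p + R (\<rho> p))) = (LINT p|lborel. ?i p *\<^sub>R R p + ?j p *\<^sub>R R p)"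
    unfolding scaleR_add_right using inti intr intj ler by simp
  also have "\<dots> = integral\<^sup>L lborel R"
    by (rule integral_cong_AE) (use c(3) in \<open>auto split: split_indicator\<close>)
  finally show "(LINT p|lborel. ?i p *\<^sub>R (R p + R (\<rho> p))) = integral\<^sup>L lborel R" .
qed

section \<open>The Macdonald function and the integrability of its kernel\<close>

lemma borel_measurable_cosh [measurable]: "(cosh :: real \<Rightarrow> real) \<in> borel_measurable borel"
  by (auto intro!: borel_measurable_continuous_onI continuous_intros)

lemma K0_lborel: "K0 x = (LINT t|lborel. indicator {0..} t *\<^sub>R exp (- x * cosh t))"
  unfolding K0_def set_lebesgue_integral_def
  by (rule lebesgue_integral_borel_cong) simp_all


lemma cosh_ge_self: "t \<le> cosh t" if "0 \<le> t" for t :: real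
proof -
  have "1 + t + t\<^sup>2 / 2 \<le> exp t" using that by (rule exp_lower_Taylor_quadratic)
  moreover have "1 - t \<le> exp (- t)" using exp_ge_add_one_self[of "-t"] by simp
  moreover have "0 \<le> (t / 2 - 1)\<^sup>2" by simp
  ultimately show ?thesis by (simp add: cosh_field_def power2_eq_square field_simps)
qed

lemma borel_measurable_K0 [measurable]: "K0 \<in> borel_measurable borel"
  unfolding K0_lborel[abs_def] by measurable

lemma integrable_K0:
  fixes x :: real
  assumes "0 < x"
  shows "integrable lborel (\<lambda>t. indicator {0..} t *\<^sub>R exp (- x * cosh t))"
proof -
  have "(\<lambda>t. exp (- x * t)) absolutely_integrable_on {0..}"
    using integrable_on_exp_minus_to_infinity[of x 0] assms
    by (intro nonnegative_absolutely_integrable_1) auto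
  then have "integrable lborel (\<lambda>t. indicator {0..} t *\<^sub>R exp (- x * t))"
    unfolding set_integrable_def by (subst (asm) integrable_completion) simp_all
  then show ?thesis
    by (rule Bochner_Integration.integrable_bound)
       (use assms cosh_ge_self in \<open>auto split: split_indicator\<close>)
qed

lemma K0_nonneg: "0 \<le> K0 x"
  unfolding K0_lborel by (rule Bochner_Integration.integral_nonneg) simp

lemma K0_antimono: "K0 y \<le> K0 x" if "0 < x" "x \<le> y"
  unfolding K0_lborel using that
  by (intro integral_mono integrable_K0) (auto split: split_indicator intro!: mult_right_mono)

lemma borel_measurable_bessel_kernel:
  fixes F :: "'e::euclidean_space \<Rightarrow> 'a::{banach, second_countable_topology}"
  assumes [measurable]: "F \<in> borel_measurable borel" "c \<in> borel_measurable borel"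
      "\<omega> \<in> borel_measurable borel"
  shows "(\<lambda>(x, p). exp (- \<omega> p * cosh (x + c p)) *\<^sub>R F p) \<in> borel_measurable borel"
  unfolding borel_prod[symmetric] by measurable

text \<open>The bound does not depend on the shift \<open>a\<close>: the integral over the line is translation
  invariant, and by evenness of \<open>cosh\<close> it is twice the integral over the half line.\<close>

lemma nn_integral_bessel_kernel:
  assumes "0 < w"
  shows "(\<integral>\<^sup>+x. ennreal (exp (- w * cosh (x + a))) \<partial>lborel) \<le> 2 * ennreal (K0 w)"
proof -
  let ?e = "\<lambda>x. ennreal (exp (- w * cosh x))"
  let ?p = "\<lambda>x. ennreal (indicator {0..} x *\<^sub>R exp (- w * cosh x))"
  have "(\<integral>\<^sup>+x. ?e (x + a) \<partial>lborel) = (\<integral>\<^sup>+x. ?e x \<partial>lborel)"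
    using nn_integral_lborel_shift[of ?e a] by (simp add: add.commute)
  also have "\<dots> \<le> (\<integral>\<^sup>+x. ?p x + ?p (0 - x) \<partial>lborel)"
    by (rule nn_integral_mono) (auto split: split_indicator)
  also have "\<dots> = (\<integral>\<^sup>+x. ?p x \<partial>lborel) + (\<integral>\<^sup>+x. ?p (0 - x) \<partial>lborel)"
    by (rule nn_integral_add) simp_all
  also have "(\<integral>\<^sup>+x. ?p (0 - x) \<partial>lborel) = (\<integral>\<^sup>+x. ?p x \<partial>lborel)"
    by (rule nn_integral_lborel_reflect) simp
  also have "(\<integral>\<^sup>+x. ?p x \<partial>lborel) = ennreal (K0 w)"
    unfolding K0_lborel by (rule nn_integral_eq_integral[OF integrable_K0[OF assms]]) simp
  finally show ?thesis by (simp add: mult_2)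
qed

text \<open>By Tonelli's theorem: integrating first in \<open>x\<close> costs at most the
  factor \<open>2 K0 (\<omega> p)\<close>, whatever the shift \<open>c p\<close>.\<close>

lemma integrable_bessel_kernel:
  fixes F :: "'e::euclidean_space \<Rightarrow> 'a::{banach, second_countable_topology}"
  assumes [measurable]: "F \<in> borel_measurable borel" "c \<in> borel_measurable borel"
      "\<omega> \<in> borel_measurable borel"
    and int: "integrable lborel (\<lambda>p. K0 (\<omega> p) *\<^sub>R F p)"
    and pos: "AE p in lborel. F p \<noteq> 0 \<longrightarrow> 0 < \<omega> p"
  shows "integrable lborel (\<lambda>(x, p). exp (- \<omega> p * cosh (x + c p)) *\<^sub>R F p)"
proof (rule integrableI_bounded)
  have "(\<integral>\<^sup>+z. ennreal (norm (case z of (x, p) \<Rightarrow> exp (- \<omega> p * cosh (x + c p)) *\<^sub>R F p)) \<partial>lborel)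
     = (\<integral>\<^sup>+p. (\<integral>\<^sup>+x. ennreal (exp (- \<omega> p * cosh (x + c p))) \<partial>lborel) * ennreal (norm (F p)) \<partial>lborel)"
    by (subst nn_integral_lborel_snd)
       (use borel_measurable_bessel_kernel[of F c \<omega>] in \<open>simp_all add: ennreal_mult nn_integral_multc\<close>)
  also have "\<dots> \<le> (\<integral>\<^sup>+p. 2 * ennreal (norm (K0 (\<omega> p) *\<^sub>R F p)) \<partial>lborel)"
  proof (rule nn_integral_mono_AE)
    show "AE p in lborel. (\<integral>\<^sup>+x. ennreal (exp (- \<omega> p * cosh (x + c p))) \<partial>lborel) * ennreal (norm (F p))
        \<le> 2 * ennreal (norm (K0 (\<omega> p) *\<^sub>R F p))"
      using pos
    proof eventually_elim
      case (elim p)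
      show ?case
      proof (cases "F p = 0")
        case False
        with elim have "(\<integral>\<^sup>+x. ennreal (exp (- \<omega> p * cosh (x + c p))) \<partial>lborel) \<le> 2 * ennreal (K0 (\<omega> p))"
          by (intro nn_integral_bessel_kernel) simp
        then have "(\<integral>\<^sup>+x. ennreal (exp (- \<omega> p * cosh (x + c p))) \<partial>lborel) * ennreal (norm (F p))
           \<le> 2 * ennreal (K0 (\<omega> p)) * ennreal (norm (F p))"
          by (rule mult_right_mono) simp
        then show ?thesis by (simp add: K0_nonneg ennreal_mult mult.assoc)
      qed simp
    qed
  qed
  also have "\<dots> < \<infinity>"
    using int unfolding integrable_iff_bounded
    by (simp add: nn_integral_cmult ennreal_mult_less_top)
  finally show "(\<integral>\<^sup>+z. ennreal (norm (case z of (x, p) \<Rightarrow> exp (- \<omega> p * cosh (x + c p)) *\<^sub>R F p)) \<partial>lborel) < \<infinity>" .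
qed measurable

section \<open>The kernel on the whole line\<close>

text \<open>The kernel of the convolution of Yakubovich and Britvina, as a function of the variable \<open>y\<close>
  that it integrates against Sneddon's convolution.\<close>

definition odd_kernel :: "real \<Rightarrow> real \<Rightarrow> real \<Rightarrow> real" where
  "odd_kernel w x y = exp (- w * cosh (y - x)) - exp (- w * cosh (y + x))"

lemma odd_kernel_minus: "odd_kernel w x (- y) = - odd_kernel w x y"
proof -
  have "- y - x = - (y + x)" "- y + x = - (y - x)" by simp_all
  then have "cosh (- y - x) = cosh (y + x)" "cosh (- y + x) = cosh (y - x)"
    by (simp_all only: cosh_minus)
  then show ?thesis by (simp only: odd_kernel_def minus_diff_eq)
qed

text \<open>The algebraic heart of the theorem: the four terms of \<open>Phi\<close> are the values of one odd kernel at
  \<open>u + v\<close> and \<open>u - v\<close>, that is, its symmetrization in \<open>v\<close>.\<close>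

lemma Phi_eq_odd_kernel: "Phi x u v w = odd_kernel w x (u + v) + odd_kernel w x (u - v)"
proof -
  have "x - u + v = - (u - v - x)" "x - u - v = - (u + v - x)" by simp_all
  then have "cosh (x - u + v) = cosh (u - v - x)" "cosh (x - u - v) = cosh (u + v - x)"
    by (simp_all only: cosh_minus)
  moreover have "x + u + v = u + v + x" "x + u - v = u - v + x" by simp_all
  ultimately show ?thesis by (simp only: Phi_def odd_kernel_def)
qed

text \<open>The common integrand behind both sides of the theorem. It is meant for \<open>F\<close> and \<open>H\<close> vanishing on
  the negative half line and for an even \<open>E\<close>, so that \<open>u\<close> and \<open>w\<close> run effectively over the half
  line but \<open>v\<close> over the whole line.\<close>

definition line_integrand ::
  "(real \<Rightarrow> 'a) \<Rightarrow> (real \<Rightarrow> 'a) \<Rightarrow> (real \<Rightarrow> 'a) \<Rightarrow> real \<Rightarrow> real \<times> real \<times> real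
    \<Rightarrow> 'a::{real_normed_field, banach, second_countable_topology}" where
  "line_integrand F E H x = (\<lambda>(u, v, w). odd_kernel w x (u + v) *\<^sub>R (F u * (E v * H w)))"

lemma integrable_line_integrand:
  fixes F E H :: "real \<Rightarrow> 'a::{real_normed_field, banach, second_countable_topology}"
  assumes F: "integrable lborel F" and E: "integrable lborel E"
    and H: "H \<in> borel_measurable borel" "integrable lborel (\<lambda>w. K0 w *\<^sub>R H w)"
      "AE w in lborel. H w \<noteq> 0 \<longrightarrow> 0 < w"
  shows "integrable lborel (\<lambda>(x, p). line_integrand F E H x p)"
proof -
  have [measurable]: "F \<in> borel_measurable borel" "E \<in> borel_measurable borel"
    using F E borel_measurable_integrable by fastforce+
  note [measurable] = H(1)
  define W where "W = (\<lambda>p. F (fst p) * (E (fst (snd p)) * H (snd (snd p))))"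
  have [measurable]: "W \<in> borel_measurable borel" unfolding W_def by measurable
  have "integrable lborel (\<lambda>(u, q). F u * (\<lambda>(v, w). E v * (K0 w *\<^sub>R H w)) q)"
    by (intro integrable_lborel_mult_prod F E H)
  then have intW: "integrable lborel (\<lambda>p. K0 (snd (snd p)) *\<^sub>R W p)"
    by (simp add: W_def case_prod_beta')
  have posW: "AE p in lborel. W p \<noteq> 0 \<longrightarrow> 0 < snd (snd p)"
    using AE_lborel_snd[OF AE_lborel_snd[OF H(3)]] by eventually_elim (auto simp: W_def)
  have int: "integrable lborel (\<lambda>(x, p). exp (- snd (snd p) * cosh (x + c p)) *\<^sub>R W p)"
    if [measurable]: "c \<in> borel_measurable borel" for c
    by (intro integrable_bessel_kernel intW posW) measurable
  have line: "line_integrand F E H x p = exp (- snd (snd p) * cosh (x + - (fst p + fst (snd p)))) *\<^sub>R W p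
      - exp (- snd (snd p) * cosh (x + (fst p + fst (snd p)))) *\<^sub>R W p" for x p
  proof -
    have "x + - (fst p + fst (snd p)) = - (fst p + fst (snd p) - x)" by simp
    then have "cosh (x + - (fst p + fst (snd p))) = cosh (fst p + fst (snd p) - x)"
      by (simp only: cosh_minus)
    then show ?thesis
      by (simp only: line_integrand_def W_def odd_kernel_def case_prod_beta scaleR_diff_left add.commute[of x])
  qed
  have "integrable lborel (\<lambda>z. (\<lambda>(x, p). exp (- snd (snd p) * cosh (x + - (fst p + fst (snd p)))) *\<^sub>R W p) z
      - (\<lambda>(x, p). exp (- snd (snd p) * cosh (x + (fst p + fst (snd p)))) *\<^sub>R W p) z)"
    by (intro Bochner_Integration.integrable_diff int) measurable
  then show ?thesis by (simp only: line case_prod_beta')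
qed

lemma integrable_even_extension:
  fixes G :: "real \<Rightarrow> 'a::{banach, second_countable_topology}"
  assumes G: "integrable lborel G"
  shows "integrable lborel (\<lambda>v. G \<bar>v\<bar>)"
proof (rule Bochner_Integration.integrable_bound)
  have [measurable]: "G \<in> borel_measurable borel"
    using G borel_measurable_integrable by fastforce
  show "integrable lborel (\<lambda>v. norm (G v) + norm (G (0 + - 1 * v)))"
    by (intro Bochner_Integration.integrable_add integrable_norm G lborel_integrable_real_affine) simp
  show "(\<lambda>v. G \<bar>v\<bar>) \<in> borel_measurable lborel" by simp
  have "norm (G \<bar>v\<bar>) \<le> norm (norm (G v) + norm (G (0 + - 1 * v)))" for v
    by (cases "v < 0") simp_all
  then show "AE v in lborel. norm (G \<bar>v\<bar>) \<le> norm (norm (G v) + norm (G (0 + - 1 * v)))"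
    by simp
qed

text \<open>Since \<open>K0\<close> is decreasing and \<open>\<beta> \<le> 1\<close>, the weight \<open>K0 (\<beta> w)\<close> dominates \<open>K0 w\<close>.\<close>

lemma K0_weighted_representative:
  fixes h H :: "real \<Rightarrow> 'a::{real_normed_field, banach, second_countable_topology}"
  assumes \<beta>: "0 < \<beta>" "\<beta> \<le> 1" and h: "h \<in> L1_0 \<beta>"
    and [measurable]: "H \<in> borel_measurable borel"
    and H: "AE w in lborel. H w = indicator {0..} w *\<^sub>R h w"
  shows "AE w in lborel. H w \<noteq> 0 \<longrightarrow> 0 < w"
    and "integrable lborel (\<lambda>w. K0 w *\<^sub>R H w)"
proof -
  show pos: "AE w in lborel. H w \<noteq> 0 \<longrightarrow> 0 < w"
    using H AE_lborel_singleton[of 0] by eventually_elim (auto split: split_indicator_asm)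
  have "integrable lebesgue (\<lambda>w. indicator {0..} w *\<^sub>R (norm (h w) * K0 (\<beta> * w)))"
    using h by (simp add: L1_0_def set_integrable_def)
  then have "integrable lborel (\<lambda>w. norm (H w) * K0 (\<beta> * w))"
  proof (subst (asm) lebesgue_integral_borel_cong)
    show "AE w in lborel. indicator {0..} w *\<^sub>R (norm (h w) * K0 (\<beta> * w)) = norm (H w) * K0 (\<beta> * w)"
      using H by eventually_elim (auto split: split_indicator)
  qed measurable
  then show "integrable lborel (\<lambda>w. K0 w *\<^sub>R H w)"
  proof (rule Bochner_Integration.integrable_bound)
    show "AE w in lborel. norm (K0 w *\<^sub>R H w) \<le> norm (norm (H w) * K0 (\<beta> * w))"
      using pos
    proof eventually_elim
      case (elim w)
      show ?case
      proof (cases "H w = 0")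
        case False
        with elim have "K0 w \<le> K0 (\<beta> * w)"
          using \<beta> by (intro K0_antimono) (auto simp: mult_left_le_one_le)
        then have "K0 w * norm (H w) \<le> K0 (\<beta> * w) * norm (H w)"
          by (rule mult_right_mono) simp
        then show ?thesis by (simp add: K0_nonneg mult.commute)
      qed simp
    qed
  qed measurable
qed

section \<open>Both convolutions as the same integral over the line\<close>

text \<open>Folding the line integral in \<open>v\<close> symmetrizes the odd kernel, which produces \<open>Phi\<close>, because
  \<open>G \<bar>v\<bar>\<close> is even.\<close>

lemma polyconv_eq_line_integral:
  fixes f g h F G H :: "real \<Rightarrow> 'a::{real_normed_field, banach, second_countable_topology}"
  assumes F: "AE u in lborel. F u = indicator {0..} u *\<^sub>R f u"
    and G: "AE v in lborel. G \<bar>v\<bar> = g \<bar>v\<bar>"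
    and H: "AE w in lborel. H w = indicator {0..} w *\<^sub>R h w"
    and R: "integrable lborel (line_integrand F (\<lambda>v. G \<bar>v\<bar>) H x)"
  shows "polyconv_integrand f g h x absolutely_integrable_on {0..} \<times> {0..} \<times> {0..}"
    and "polyconv f g h x = (1 / (2 * sqrt (2 * pi))) *\<^sub>R integral\<^sup>L lborel (line_integrand F (\<lambda>v. G \<bar>v\<bar>) H x)"
proof -
  let ?R = "line_integrand F (\<lambda>v. G \<bar>v\<bar>) H x"
  let ?\<rho> = "\<lambda>p::real \<times> real \<times> real. (fst p, - fst (snd p), snd (snd p))"
  let ?L = "\<lambda>p. indicator {0..} (fst (snd p)) *\<^sub>R (?R p + ?R (?\<rho> p))"
  have ne: "AE p :: real \<times> real \<times> real in lborel. fst (snd p) \<noteq> 0"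
    by (rule AE_lborel_snd, rule AE_lborel_fst, rule AE_lborel_singleton)
  have fold: "integrable lborel ?L" "integral\<^sup>L lborel ?L = integral\<^sup>L lborel ?R"
    by (rule integral_fold_reflection[OF R _ lborel_distr_reflect_middle _ _ ne]; simp)+
  have ae: "AE p in lborel. indicator ({0..} \<times> {0..} \<times> {0..}) p *\<^sub>R polyconv_integrand f g h x p = ?L p"
    using AE_lborel_fst[OF F] AE_lborel_snd[OF AE_lborel_fst[OF G]] AE_lborel_snd[OF AE_lborel_snd[OF H]]
  proof eventually_elim
    case (elim p)
    then show ?case
      by (cases p) (auto simp: polyconv_integrand_def line_integrand_def Phi_eq_odd_kernel mult.assoc
        scaleR_add_left split: split_indicator)
  qed
  have L: "?L \<in> borel_measurable borel" using borel_measurable_integrable[OF fold(1)] by simp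
  show "polyconv_integrand f g h x absolutely_integrable_on {0..} \<times> {0..} \<times> {0..}"
    unfolding set_integrable_def using lebesgue_integral_borel_cong(1)[OF L ae] fold(1) by simp
  show "polyconv f g h x = (1 / (2 * sqrt (2 * pi))) *\<^sub>R integral\<^sup>L lborel ?R"
    unfolding polyconv_def set_lebesgue_integral_def
    using lebesgue_integral_borel_cong(2)[OF L ae] fold(2) by simp
qed

text \<open>With the even extension \<open>E v = G \<bar>v\<bar>\<close>, the second term \<open>g (y + u)\<close> of Sneddon's integrand is
  \<open>E (- y - u)\<close>: the convolution is the odd part in \<open>y\<close> of an ordinary convolution on the line.\<close>

lemma sneddon_conv_eq_line_integral:
  fixes f g F G :: "real \<Rightarrow> 'a::{real_normed_field, banach, second_countable_topology}"
  assumes F: "AE u in lborel. F u = indicator {0..} u *\<^sub>R f u"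
    and G: "AE v in lborel. G \<bar>v\<bar> = g \<bar>v\<bar>"
    and y: "0 \<le> y"
    and int1: "integrable lborel (\<lambda>u. F u * G \<bar>y - u\<bar>)" and int2: "integrable lborel (\<lambda>u. F u * G \<bar>- y - u\<bar>)"
  shows "sneddon_integrand f g y absolutely_integrable_on {0..}"
    and "sneddon_conv f g y = (1 / sqrt (2 * pi)) *\<^sub>R
      ((LINT u|lborel. F u * G \<bar>y - u\<bar>) - (LINT u|lborel. F u * G \<bar>- y - u\<bar>))"
proof -
  let ?L = "\<lambda>u. F u * G \<bar>y - u\<bar> - F u * G \<bar>- y - u\<bar>"
  have G': "AE u in lborel. G \<bar>t - u\<bar> = g \<bar>t - u\<bar>" for t
    using G by (rule AE_lborel_reflect)
  have int: "integrable lborel ?L" using int1 int2 by simp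
  have L: "?L \<in> borel_measurable borel" using borel_measurable_integrable[OF int] by simp
  have ae: "AE u in lborel. indicator {0..} u *\<^sub>R sneddon_integrand f g y u = ?L u"
    using F G'[of y] G'[of "- y"]
  proof eventually_elim
    case (elim u)
    have "0 \<le> u \<Longrightarrow> \<bar>- y - u\<bar> = y + u" using y by simp
    with elim show ?case
      by (auto simp: sneddon_integrand_def algebra_simps split: split_indicator)
  qed
  show "sneddon_integrand f g y absolutely_integrable_on {0..}"
    unfolding set_integrable_def using lebesgue_integral_borel_cong(1)[OF L ae] int by simp
  show "sneddon_conv f g y = (1 / sqrt (2 * pi)) *\<^sub>R
      ((LINT u|lborel. F u * G \<bar>y - u\<bar>) - (LINT u|lborel. F u * G \<bar>- y - u\<bar>))"
    unfolding sneddon_conv_def set_lebesgue_integral_def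
    using lebesgue_integral_borel_cong(2)[OF L ae] int1 int2 by simp
qed

lemma AE_integrable_convolution:
  fixes F E :: "real \<Rightarrow> 'a::{real_normed_field, banach, second_countable_topology}"
  assumes F: "integrable lborel F" and E: "integrable lborel E"
  shows "AE y in lborel. integrable lborel (\<lambda>u. F u * E (y - u))"
proof -
  let ?T = "\<lambda>p::real \<times> real. (snd p, fst p - snd p)"
  have "integrable lborel (\<lambda>p. (\<lambda>(u, v). F u * E v) (?T p))"
    using integrable_lborel_mult_prod[OF F E]
    by (subst integrable_distr_eq[symmetric, where N = borel])
       (auto simp: lborel_distr_shear dest: borel_measurable_integrable)
  then show ?thesis
    by (intro integrable_lborel_slices) (simp add: case_prod_beta')
qed

text \<open>Unfolding in \<open>y\<close>: an integral over the half line of an odd kernel against an odd part is an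
  integral over the whole line of the kernel against the ordinary convolution of \<open>F\<close> and \<open>E\<close>;
  the shear then separates the variables of \<open>F\<close> and \<open>E\<close>.\<close>

lemma yb_conv_eq_line_integral:
  fixes S h F E H :: "real \<Rightarrow> 'a::{real_normed_field, banach, second_countable_topology}"
  assumes S: "AE y in lborel. 0 \<le> y \<longrightarrow>
      S y = c *\<^sub>R ((LINT u|lborel. F u * E (y - u)) - (LINT u|lborel. F u * E (- y - u)))"
    and int: "AE y in lborel. integrable lborel (\<lambda>u. F u * E (y - u))"
    and H: "AE w in lborel. H w = indicator {0..} w *\<^sub>R h w"
    and R: "integrable lborel (line_integrand F E H x)"
  shows "yb_integrand S h x absolutely_integrable_on {0..} \<times> {0..}"
    and "yb_conv S h x = (c / 2) *\<^sub>R integral\<^sup>L lborel (line_integrand F E H x)"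
proof -
  let ?R = "line_integrand F E H x"
  let ?T = "\<lambda>p::(real \<times> real) \<times> real. (snd p, snd (fst p) - snd p, fst (fst p))"
  let ?\<rho> = "\<lambda>p::real \<times> real. (fst p, - snd p)"
  (* kernel times the convolution of F and E, before its odd part in y is taken *)
  define Q where "Q q = (LINT u|lborel. ?R (?T (q, u)))" for q
  have [measurable]: "?R \<in> borel_measurable borel" using borel_measurable_integrable[OF R] by simp
  have intP: "integrable lborel (\<lambda>p. ?R (?T p))"
    using R by (subst integrable_distr_eq[symmetric, where N = borel]) (auto simp: lborel_distr_shear_weighted)
  have eqP: "(LINT p|lborel. ?R (?T p)) = integral\<^sup>L lborel ?R"
    by (subst integral_distr[symmetric, where N = borel]) (auto simp: lborel_distr_shear_weighted)
  have intQ: "integrable lborel Q" and eqQ: "integral\<^sup>L lborel Q = integral\<^sup>L lborel ?R"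
    using integrable_lborel_slices(2,3)[of "\<lambda>q u. ?R (?T (q, u))"] intP eqP
    by (simp_all add: Q_def[abs_def] case_prod_beta')
  let ?L = "\<lambda>q. c *\<^sub>R (indicator {0..} (snd q) *\<^sub>R (Q q + Q (?\<rho> q)))"
  have ne: "AE q :: real \<times> real in lborel. snd q \<noteq> 0"
    by (rule AE_lborel_snd, rule AE_lborel_singleton)
  have fold: "integrable lborel ?L" "integral\<^sup>L lborel ?L = c *\<^sub>R integral\<^sup>L lborel ?R"
    using integral_fold_reflection[OF intQ _ lborel_distr_reflect_snd _ _ ne] eqQ
    by (simp_all del: scaleR_scaleR)
  have Q_eq: "Q (w, y) = odd_kernel w x y *\<^sub>R ((LINT u|lborel. F u * E (y - u)) * H w)"
    if "integrable lborel (\<lambda>u. F u * E (y - u))" for w y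
    using that by (simp add: Q_def line_integrand_def mult.assoc[symmetric])
  have int': "AE y in lborel. integrable lborel (\<lambda>u. F u * E (- y - u))"
    using AE_lborel_reflect[OF int, of 0] by simp
  have ae: "AE q in lborel. indicator ({0..} \<times> {0..}) q *\<^sub>R yb_integrand S h x q = ?L q"
    using AE_lborel_snd[OF S] AE_lborel_snd[OF int] AE_lborel_snd[OF int'] AE_lborel_fst[OF H]
  proof eventually_elim
    case (elim q)
    obtain w y where q: "q = (w, y)" by (cases q)
    show ?case
    proof (cases "0 \<le> w \<and> 0 \<le> y")
      case True
      with elim have "H w = h w" "S y = c *\<^sub>R ((LINT u|lborel. F u * E (y - u)) - (LINT u|lborel. F u * E (- y - u)))"
        unfolding q by simp_all
      moreover have "Q (w, y) + Q (w, - y) = odd_kernel w x y *\<^sub>R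
          (((LINT u|lborel. F u * E (y - u)) - (LINT u|lborel. F u * E (- y - u))) * H w)"
        using elim unfolding q by (simp add: Q_eq odd_kernel_minus left_diff_distrib scaleR_diff_right)
      ultimately show ?thesis
        using True unfolding q by (simp add: yb_integrand_def odd_kernel_def)
    next
      case False
      then show ?thesis
        using elim unfolding q by (auto simp: Q_eq split: split_indicator)
    qed
  qed
  have L: "?L \<in> borel_measurable borel" using borel_measurable_integrable[OF fold(1)] by simp
  show "yb_integrand S h x absolutely_integrable_on {0..} \<times> {0..}"
    unfolding set_integrable_def using lebesgue_integral_borel_cong(1)[OF L ae] fold(1) by simp
  show "yb_conv S h x = (c / 2) *\<^sub>R integral\<^sup>L lborel ?R"
    unfolding yb_conv_def set_lebesgue_integral_def
    using lebesgue_integral_borel_cong(2)[OF L ae] fold(2) by simp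
qed

section \<open>The factorization of the polyconvolution\<close>

theorem mainTheorem6:
  fixes f g h :: "real \<Rightarrow> 'a::{real_normed_field, banach, second_countable_topology}"
    and \<beta> :: real
  assumes "0 < \<beta>" and "\<beta> \<le> 1"
    and "f absolutely_integrable_on {0..}"
    and "g absolutely_integrable_on {0..}"
    and "h \<in> L1_0 \<beta>"
  shows "(AE x in lebesgue. 0 < x \<longrightarrow> sneddon_integrand f g x absolutely_integrable_on {0..}) \<and>
    (AE x in lebesgue. 0 < x \<longrightarrow>
       polyconv_integrand f g h x absolutely_integrable_on {0..} \<times> {0..} \<times> {0..} \<and>
       yb_integrand (sneddon_conv f g) h x absolutely_integrable_on {0..} \<times> {0..} \<and>
       polyconv f g h x = yb_conv (sneddon_conv f g) h x) \<and>
    polyconv f g h absolutely_integrable_on {0..}"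
proof -
  let ?i = "indicator {0..} :: real \<Rightarrow> real"
  have rep: "\<exists>K. K \<in> borel_measurable borel \<and> (AE u in lborel. K u = ?i u *\<^sub>R k u)"
    if k: "(\<lambda>u. ?i u *\<^sub>R k u) \<in> borel_measurable lebesgue" for k :: "real \<Rightarrow> 'a"
  proof -
    obtain K where "K \<in> borel_measurable lborel" "AE u in lborel. ?i u *\<^sub>R k u = K u"
      using borel_representative[OF k] .
    then show ?thesis by (intro exI[of _ K]) (simp add: eq_commute)
  qed
  have f: "integrable lebesgue (\<lambda>u. ?i u *\<^sub>R f u)" and g: "integrable lebesgue (\<lambda>u. ?i u *\<^sub>R g u)"
    using assms(3,4) by (simp_all add: set_integrable_def)
  have h: "(\<lambda>u. ?i u *\<^sub>R h u) \<in> borel_measurable lebesgue"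
    using assms(5) by (simp add: L1_0_def set_borel_measurable_def)
  obtain F where F[measurable]: "F \<in> borel_measurable borel" "AE u in lborel. F u = ?i u *\<^sub>R f u"
    using rep[OF borel_measurable_integrable[OF f]] by blast
  obtain G where G[measurable]: "G \<in> borel_measurable borel" "AE u in lborel. G u = ?i u *\<^sub>R g u"
    using rep[OF borel_measurable_integrable[OF g]] by blast
  obtain H where H[measurable]: "H \<in> borel_measurable borel" "AE u in lborel. H u = ?i u *\<^sub>R h u"
    using rep[OF h] by blast
  (* Only the values of g on the half line matter; its even extension removes the
     absolute value in Sneddon's integrand. *)
  define E where "E v = G \<bar>v\<bar>" for v
  have intF: "integrable lborel F"
    using f F(2) by (subst (asm) lebesgue_integral_borel_cong(1)[OF F(1)]) auto
  have "integrable lborel G"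
    using g G(2) by (subst (asm) lebesgue_integral_borel_cong(1)[OF G(1)]) auto
  then have intE: "integrable lborel E"
    unfolding E_def by (rule integrable_even_extension)
  have "AE v in lborel. G (0 - v) = ?i (0 - v) *\<^sub>R g (0 - v)"
    using G(2) by (rule AE_lborel_reflect)
  with G(2) have E: "AE v in lborel. E v = g \<bar>v\<bar>"
    by eventually_elim (auto simp: E_def abs_if split: split_indicator_asm)
  note E' = E[unfolded E_def]
  note intH = K0_weighted_representative[OF assms(1,2,5) H]
  let ?R = "line_integrand F E H"
  have R: "integrable lborel (\<lambda>(x, p). ?R x p)"
    by (intro integrable_line_integrand intF intE H intH)
  have conv: "AE y in lborel. integrable lborel (\<lambda>u. F u * E (y - u))"
    by (intro AE_integrable_convolution intF intE)
  have conv': "AE y in lborel. integrable lborel (\<lambda>u. F u * E (0 - y - u))"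
    using conv by (rule AE_lborel_reflect)
  have sneddon: "AE y in lborel. 0 \<le> y \<longrightarrow> sneddon_integrand f g y absolutely_integrable_on {0..} \<and>
     sneddon_conv f g y = (1 / sqrt (2 * pi)) *\<^sub>R
       ((LINT u|lborel. F u * E (y - u)) - (LINT u|lborel. F u * E (- y - u)))"
    using conv conv'
    by eventually_elim
       (use sneddon_conv_eq_line_integral[OF F(2) E'] in \<open>auto simp: E_def\<close>)
  have poly: "AE x in lborel. polyconv_integrand f g h x absolutely_integrable_on {0..} \<times> {0..} \<times> {0..} \<and>
      polyconv f g h x = (1 / (2 * sqrt (2 * pi))) *\<^sub>R integral\<^sup>L lborel (?R x)"
    using integrable_lborel_slices(1)[OF R]
    by eventually_elim
       (use polyconv_eq_line_integral[OF F(2) E' H(2)] in \<open>simp add: E_def[abs_def]\<close>)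
  have yb: "AE x in lborel. yb_integrand (sneddon_conv f g) h x absolutely_integrable_on {0..} \<times> {0..} \<and>
      yb_conv (sneddon_conv f g) h x = (1 / sqrt (2 * pi) / 2) *\<^sub>R integral\<^sup>L lborel (?R x)"
    using integrable_lborel_slices(1)[OF R]
  proof eventually_elim
    case (elim x)
    have "AE y in lborel. 0 \<le> y \<longrightarrow> sneddon_conv f g y = (1 / sqrt (2 * pi)) *\<^sub>R
       ((LINT u|lborel. F u * E (y - u)) - (LINT u|lborel. F u * E (- y - u)))"
      using sneddon by eventually_elim simp
    from yb_conv_eq_line_integral[OF this conv H(2) elim] show ?case by simp
  qed
  have "AE x in lborel. 0 < x \<longrightarrow> sneddon_integrand f g x absolutely_integrable_on {0..}"
    using sneddon by eventually_elim simp
  moreover have "AE x in lborel. 0 < x \<longrightarrow>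
       polyconv_integrand f g h x absolutely_integrable_on {0..} \<times> {0..} \<times> {0..} \<and>
       yb_integrand (sneddon_conv f g) h x absolutely_integrable_on {0..} \<times> {0..} \<and>
       polyconv f g h x = yb_conv (sneddon_conv f g) h x"
    using poly yb by eventually_elim (simp add: mult.commute)
  moreover have "polyconv f g h absolutely_integrable_on {0..}"
  proof -
    let ?L = "\<lambda>x. ?i x *\<^sub>R (1 / (2 * sqrt (2 * pi))) *\<^sub>R integral\<^sup>L lborel (?R x)"
    have "integrable lborel (\<lambda>x. (1 / (2 * sqrt (2 * pi))) *\<^sub>R integral\<^sup>L lborel (?R x))"
      using integrable_lborel_slices(2)[OF R] by simp
    then have int: "integrable lborel ?L"
      by (intro integrable_mult_indicator) simp_all
    have L: "?L \<in> borel_measurable borel" using borel_measurable_integrable[OF int] by simp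
    have "AE x in lborel. ?i x *\<^sub>R polyconv f g h x = ?L x"
      using poly by eventually_elim simp
    from lebesgue_integral_borel_cong(1)[OF L this] int show ?thesis
      unfolding set_integrable_def by simp
  qed
  ultimately show ?thesis by (blast intro: AE_completion)
qed

end
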